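(* Let $\iota:\mathbb{P}^1(\mathbb{Q})\to\mathbb{P}^2(\mathbb{Q})$, $[r:s]\mapsto[r:s:0]$, and $\iota_q:\mathbb{P}^1(\mathbb{Z}(q))\to\mathbb{P}^2(\mathbb{Z}(q))$, $[R(q):S(q)]\mapsto[R(q):S(q):0]$. The quantization of the projective line (Morier-Genoud–Ovsienko $q$-rationals) and the quantization of the projective plane commute with these embeddings: for every $[r:s]\in\mathbb{P}^1(\mathbb{Q})$, $$\iota_q(\mathcal{Q}_1([r:s]))\in \mathcal{Q}_2(\iota([r:s])),$$ where $\mathcal{Q}_1$ denotes the quantization map of $\mathbb{P}^1(\mathbb{Q})$ and $\mathcal{Q}_2$ the (set-valued) quantization map of $\mathbb{P}^2(\mathbb{Q})$.
   Context: $q$ is a formal variable, $\Lambda=\mathbb{Z}[q,q^{-1}]$, and $\mathbb{Z}(q)=\mathbb{Q}(q)$ is the field of rational functions in $q$. Braid group $B_4$: generated by $\sigma_1,\sigma_2,\sigma_3$ with $\sigma_1\sigma_2\sigma_1=\sigma_2\sigma_1\sigma_2$, $\sigma_2\sigma_3\sigma_2=\sigma_3\sigma_2\sigma_3$, $\sigma_1\sigma_3=\sigma_3\sigma_1$. Its reduced Burau representation $\rho_q:B_4\to\mathrm{GL}_3(\Lambda)$ is $$\rho_q(\sigma_1)=\begin{pmatrix}q&1&0\\0&1&0\\0&0&1\end{pmatrix},\quad \rho_q(\sigma_2)=\begin{pmatrix}1&0&0\\-q&q&1\\0&0&1\end{pmatrix},\quad \rho_q(\sigma_3)=\begin{pmatrix}1&0&0\\0&1&0\\0&-q&q\end{pmatrix},$$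 acting on $\mathbb{P}^2(\mathbb{Z}(q))$ by matrix multiplication on column vectors of homogeneous coordinates. Its specialization at $q=1$ is denoted $\rho:B_4\to\mathrm{SL}_3(\mathbb{Z})$ and acts on $\mathbb{P}^2(\mathbb{Q})$. Quantization $\mathcal{Q}_2$ of the plane: the principal orbit is $\mathcal{O}_1=\{\rho(\beta)([0:1:0]) : \beta\in B_4\}\subset\mathbb{P}^2(\mathbb{Q})$, and for $p\in\mathcal{O}_1$, $$\mathcal{Q}_2(p)=\{\rho_q(\beta)([0:1:0])\ |\ \beta\in B_4,\ \rho(\beta)([0:1:0])=p\}\subset\mathbb{P}^2(\mathbb{Z}(q)).$$ The image of $\iota$ is contained in $\mathcal{O}_1$. Quantization $\mathcal{Q}_1$ of the line: the braid group $B_3=\langle\sigma_1,\sigma_2\mid\sigma_1\sigma_2\sigma_1=\sigma_2\sigma_1\sigma_2\rangle$ acts on $\mathbb{P}^1(\mathbb{Z}(q))$ by $\sigma_1:[r:s]\mapsto[qr+s:s]$ and $\sigma_2:[r:s]\mapsto[r:q(s-r)]$ (reduced Burau representation of $B_3$), and on $\mathbb{P}^1(\mathbb{Q})$ by the same formulas at $q=1$. Both actions factor through $\mathrm{PSL}(2,\mathbb{Z})$, and the action on $\mathbb{P}^1(\mathbb{Q})$ is transitive. $\mathcal{Q}_1:\mathbb{P}^1(\mathbb{Q})\to\mathbb{P}^1(\mathbb{Z}(q))$ is the unique (single-valued) map that commutes with these actions and sends $[0:1]$ to $[0:1]$. *)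

theory Defs
  imports
    "HOL-Analysis.Analysis"
    "HOL-Algebra.Group"
    "HOL-Computational_Algebra.Polynomial"
    "HOL-Computational_Algebra.Fraction_Field"
begin

section \<open>Groups given by generators and relations\<close>

text \<open>A letter \<open>(s, True)\<close> stands for the generator \<open>s\<close>, a letter \<open>(s, False)\<close> for its
  formal inverse.\<close>

type_synonym 'g word = "('g \<times> bool) list"

definition words :: "'g set \<Rightarrow> 'g word set" where
  "words S = lists (S \<times> UNIV)"

inductive word_eq :: "'g set \<Rightarrow> ('g word \<times> 'g word) set \<Rightarrow> 'g word \<Rightarrow> 'g word \<Rightarrow> bool"
  for S R where
  refl: "w \<in> words S \<Longrightarrow> word_eq S R w w"
| sym: "word_eq S R u v \<Longrightarrow> word_eq S R v u"
| trans: "word_eq S R u v \<Longrightarrow> word_eq S R v w \<Longrightarrow> word_eq S R u w"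
| append: "word_eq S R u u' \<Longrightarrow> word_eq S R v v' \<Longrightarrow> word_eq S R (u @ v) (u' @ v')"
| cancel: "s \<in> S \<Longrightarrow> word_eq S R [(s, b), (s, \<not> b)] []"
| relation: "(u, v) \<in> R \<Longrightarrow> u \<in> words S \<Longrightarrow> v \<in> words S \<Longrightarrow> word_eq S R u v"

definition word_class :: "'g set \<Rightarrow> ('g word \<times> 'g word) set \<Rightarrow> 'g word \<Rightarrow> 'g word set" where
  "word_class S R w = {v. word_eq S R w v}"

definition presented_group :: "'g set \<Rightarrow> ('g word \<times> 'g word) set \<Rightarrow> 'g word set monoid" where
  "presented_group S R =
    \<lparr>carrier = word_class S R ` words S,
     mult = (\<lambda>X Y. {z. \<exists>x\<in>X. \<exists>y\<in>Y. word_eq S R (x @ y) z}),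
     one = word_class S R []\<rparr>"

lemma word_eq_words: "word_eq S R u v \<Longrightarrow> u \<in> words S \<and> v \<in> words S"
  by (induction rule: word_eq.induct) (auto simp: words_def)

lemma word_class_self: "w \<in> words S \<Longrightarrow> w \<in> word_class S R w"
  by (simp add: word_class_def word_eq.refl)

lemma word_class_cong: "word_eq S R u v \<Longrightarrow> word_class S R u = word_class S R v"
  unfolding word_class_def by (blast intro: word_eq.sym word_eq.trans)

lemma mult_word_class:
  assumes "u \<in> words S" "v \<in> words S"
  shows "word_class S R u \<otimes>\<^bsub>presented_group S R\<^esub> word_class S R v = word_class S R (u @ v)"
  using assms
  by (auto simp: presented_group_def word_class_def intro: word_eq.append word_eq.refl
      word_eq.trans)

lemma carrier_presented_group: "carrier (presented_group S R) = word_class S R ` words S"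
  by (simp add: presented_group_def)

lemma append_words: "u \<in> words S \<Longrightarrow> v \<in> words S \<Longrightarrow> u @ v \<in> words S"
  by (simp add: words_def)

lemma Nil_words: "[] \<in> words S"
  by (simp add: words_def)

lemma word_left_inverse:
  assumes "w \<in> words S"
  shows "\<exists>v\<in>words S. word_eq S R (v @ w) []"
  using assms
proof (induction w)
  case Nil
  then show ?case by (auto intro!: bexI[of _ "[]"] word_eq.refl simp: Nil_words)
next
  case (Cons a w)
  obtain s b where a: "a = (s, b)" by (cases a)
  have s: "s \<in> S" and w: "w \<in> words S" using Cons.prems by (auto simp: words_def a)
  obtain v where v: "v \<in> words S" "word_eq S R (v @ w) []" using Cons.IH w by blast
  have "word_eq S R [(s, \<not> b), (s, b)] []" using word_eq.cancel[OF s, of R "\<not> b"] by simp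
  then have "word_eq S R (v @ ([(s, \<not> b), (s, b)] @ w)) (v @ ([] @ w))"
    by (intro word_eq.append word_eq.refl v w)
  then have "word_eq S R ((v @ [(s, \<not> b)]) @ a # w) []"
    using v(2) by (auto simp: a intro: word_eq.trans)
  moreover have "v @ [(s, \<not> b)] \<in> words S" using v s by (simp add: words_def)
  ultimately show ?case by blast
qed

lemma group_presented_group: "group (presented_group S R)"
proof (rule groupI)
  fix X assume "X \<in> carrier (presented_group S R)"
  then obtain w where w: "X = word_class S R w" "w \<in> words S"
    by (auto simp: carrier_presented_group)
  obtain v where v: "v \<in> words S" "word_eq S R (v @ w) []"
    using word_left_inverse[OF w(2)] by blast
  show "\<exists>Y\<in>carrier (presented_group S R). Y \<otimes>\<^bsub>presented_group S R\<^esub> X = \<one>\<^bsub>presented_group S R\<^esub>"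
    by (rule bexI[of _ "word_class S R v"])
      (use v w in \<open>simp_all add: mult_word_class word_class_cong carrier_presented_group,
        simp add: presented_group_def\<close>)
next
  fix X assume "X \<in> carrier (presented_group S R)"
  then show "\<one>\<^bsub>presented_group S R\<^esub> \<otimes>\<^bsub>presented_group S R\<^esub> X = X"
    using mult_word_class[OF Nil_words, of _ S R]
    by (auto simp: carrier_presented_group presented_group_def)
qed (auto simp: carrier_presented_group mult_word_class append_words Nil_words
    presented_group_def[THEN arg_cong[where f = one]])

section \<open>Braid groups\<close>

abbreviation sigma :: "nat \<Rightarrow> nat \<times> bool" where
  "sigma i \<equiv> (i, True)"

definition braid_relations :: "nat \<Rightarrow> (nat word \<times> nat word) set" where
  "braid_relations n =
    {([sigma i, sigma (i + 1), sigma i], [sigma (i + 1), sigma i, sigma (i + 1)]) |i.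
       1 \<le> i \<and> i + 1 < n} \<union>
    {([sigma i, sigma j], [sigma j, sigma i]) |i j. 1 \<le> i \<and> i + 1 < j \<and> j < n}"

definition braid_group :: "nat \<Rightarrow> nat word set monoid" where
  "braid_group n = presented_group {1..<n} (braid_relations n)"

definition braid_gen :: "nat \<Rightarrow> nat \<Rightarrow> nat word set" where
  "braid_gen n i = word_class {1..<n} (braid_relations n) [sigma i]"

lemma group_braid_group: "group (braid_group n)"
  by (simp add: braid_group_def group_presented_group)

section \<open>Matrix representations of presented groups\<close>

primrec word_matrix :: "('g \<Rightarrow> 'a::field^'n^'n) \<Rightarrow> 'g word \<Rightarrow> 'a^'n^'n" where
  "word_matrix G [] = mat 1"
| "word_matrix G (a # w) =
    (if snd a then G (fst a) else matrix_inv (G (fst a))) ** word_matrix G w"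

text \<open>When the matrices \<open>G s\<close> are invertible and satisfy the defining relations,
  \<^const>\<open>word_matrix\<close> is constant on each class \<open>X\<close>, and this is its value there (lemma
  \<open>class_matrix_word_class\<close>).\<close>

definition class_matrix :: "('g \<Rightarrow> 'a::field^'n^'n) \<Rightarrow> 'g word set \<Rightarrow> 'a^'n^'n" where
  "class_matrix G X = the_elem (word_matrix G ` X)"

lemma matrix_inv_mult:
  fixes A :: "'a::field^'n^'n"
  assumes "invertible A"
  shows "A ** matrix_inv A = mat 1" "matrix_inv A ** A = mat 1"
  using someI_ex[OF assms[unfolded invertible_def]] by (simp_all add: matrix_inv_def)

lemma matrix_inv_unique:
  fixes A :: "'a::field^'n^'n"
  assumes "A ** B = mat 1" "B ** A = mat 1"
  shows "matrix_inv A = B"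
proof -
  have "invertible A" using assms by (auto simp: invertible_def)
  then have "matrix_inv A = matrix_inv A ** (A ** B)" using assms by simp
  also have "\<dots> = B" using \<open>invertible A\<close> by (simp add: matrix_mul_assoc matrix_inv_mult)
  finally show ?thesis .
qed

lemma invertible_matrix_inv:
  fixes A :: "'a::field^'n^'n"
  assumes "invertible A"
  shows "invertible (matrix_inv A)"
  using matrix_inv_mult[OF assms] by (auto simp: invertible_def)

lemma word_matrix_append: "word_matrix G (u @ v) = word_matrix G u ** word_matrix G v"
  by (induction u) (simp_all add: matrix_mul_assoc)

lemma word_matrix_invertible:
  assumes "\<And>s. s \<in> S \<Longrightarrow> invertible (G s)" "w \<in> words S"
  shows "invertible (word_matrix G w)"
  using assms(2)
proof (induction w)
  case Nil
  then show ?case by (auto simp: invertible_def intro: exI[of _ "mat 1"])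
next
  case (Cons a w)
  then have "invertible (G (fst a))" "w \<in> words S"
    using assms(1) by (auto simp: words_def)
  then show ?case
    using Cons.IH by (auto intro!: invertible_mult invertible_matrix_inv)
qed

lemma word_matrix_cong:
  assumes "\<And>s. s \<in> S \<Longrightarrow> invertible (G s)"
    and "\<And>u v. (u, v) \<in> R \<Longrightarrow> word_matrix G u = word_matrix G v"
    and "word_eq S R u v"
  shows "word_matrix G u = word_matrix G v"
  using assms(3)
proof (induction rule: word_eq.induct)
  case (cancel s b)
  then show ?case using assms(1)[of s] by (cases b) (simp_all add: matrix_inv_mult)
next
  case (relation u v)
  then show ?case by (intro assms(2))
qed (simp_all add: word_matrix_append)

lemma class_matrix_word_class:
  assumes "\<And>s. s \<in> S \<Longrightarrow> invertible (G s)"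
    and "\<And>u v. (u, v) \<in> R \<Longrightarrow> word_matrix G u = word_matrix G v"
    and "w \<in> words S"
  shows "class_matrix G (word_class S R w) = word_matrix G w"
proof -
  have "word_matrix G v = word_matrix G w" if "v \<in> word_class S R w" for v
    using word_matrix_cong[of S G R, OF assms(1,2) word_eq.sym] that
    by (simp add: word_class_def)
  then have "word_matrix G ` word_class S R w = {word_matrix G w}"
    using word_class_self[OF assms(3), of R] by blast
  then show ?thesis by (simp add: class_matrix_def)
qed

section \<open>Reduced Burau representations of the braid groups on three and four strands\<close>

text \<open>The parameter \<open>t\<close> is a nonzero element of an arbitrary field, so that the same definition
  yields the representation over the rational functions (\<open>t\<close> the variable) and its
  specialization (\<open>t = 1\<close> in the rationals).\<close>

definition burau4_gen :: "'a::field \<Rightarrow> nat \<Rightarrow> 'a^3^3" where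
  "burau4_gen t i =
    (if i = 1 then vector [vector [t, 1, 0], vector [0, 1, 0], vector [0, 0, 1]]
     else if i = 2 then vector [vector [1, 0, 0], vector [- t, t, 1], vector [0, 0, 1]]
     else vector [vector [1, 0, 0], vector [0, 1, 0], vector [0, - t, t]])"

definition burau4 :: "'a::field \<Rightarrow> nat word set \<Rightarrow> 'a^3^3" where
  "burau4 t = class_matrix (burau4_gen t)"

definition burau3_gen :: "'a::field \<Rightarrow> nat \<Rightarrow> 'a^2^2" where
  "burau3_gen t i =
    (if i = 1 then vector [vector [t, 1], vector [0, 1]]
     else vector [vector [1, 0], vector [- t, t]])"

definition burau3 :: "'a::field \<Rightarrow> nat word set \<Rightarrow> 'a^2^2" where
  "burau3 t = class_matrix (burau3_gen t)"

definition burau4_gen_inv :: "'a::field \<Rightarrow> nat \<Rightarrow> 'a^3^3" where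
  "burau4_gen_inv t i =
    (if i = 1 then vector [vector [1 / t, - 1 / t, 0], vector [0, 1, 0], vector [0, 0, 1]]
     else if i = 2 then vector [vector [1, 0, 0], vector [1, 1 / t, - 1 / t], vector [0, 0, 1]]
     else vector [vector [1, 0, 0], vector [0, 1, 0], vector [0, 1, 1 / t]])"

definition burau3_gen_inv :: "'a::field \<Rightarrow> nat \<Rightarrow> 'a^2^2" where
  "burau3_gen_inv t i =
    (if i = 1 then vector [vector [1 / t, - 1 / t], vector [0, 1]]
     else vector [vector [1, 0], vector [1, 1 / t]])"

lemmas matrix_entry_simps =
  matrix_matrix_mult_def mat_def vec_eq_iff forall_2 forall_3 sum_2 sum_3

lemma burau4_gen_inverse:
  assumes "t \<noteq> 0"
  shows "burau4_gen t i ** burau4_gen_inv t i = mat 1" "burau4_gen_inv t i ** burau4_gen t i = mat 1"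
  using assms by (simp_all add: burau4_gen_def burau4_gen_inv_def matrix_entry_simps)

lemma burau3_gen_inverse:
  assumes "t \<noteq> 0"
  shows "burau3_gen t i ** burau3_gen_inv t i = mat 1" "burau3_gen_inv t i ** burau3_gen t i = mat 1"
  using assms by (simp_all add: burau3_gen_def burau3_gen_inv_def matrix_entry_simps)

lemma invertible_burau4_gen: "t \<noteq> 0 \<Longrightarrow> invertible (burau4_gen t i)"
  using burau4_gen_inverse unfolding invertible_def by blast

lemma invertible_burau3_gen: "t \<noteq> 0 \<Longrightarrow> invertible (burau3_gen t i)"
  using burau3_gen_inverse unfolding invertible_def by blast

lemma burau4_gen_relations:
  assumes "(u, v) \<in> braid_relations 4"
  shows "word_matrix (burau4_gen t) u = word_matrix (burau4_gen t) v"
proof -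
  consider i where "i = 1 \<or> i = 2"
      "u = [sigma i, sigma (i + 1), sigma i]" "v = [sigma (i + 1), sigma i, sigma (i + 1)]"
    | "u = [sigma 1, sigma 3]" "v = [sigma 3, sigma 1]"
  proof -
    have "i = 1 \<and> j = 3" if "1 \<le> i" "i + 1 < j" "j < 4" for i j :: nat using that by arith
    moreover have "i = 1 \<or> i = 2" if "1 \<le> i" "i + 1 < 4" for i :: nat using that by arith
    ultimately show ?thesis using assms that unfolding braid_relations_def by blast
  qed
  then show ?thesis
    by cases (auto simp: burau4_gen_def matrix_entry_simps algebra_simps)
qed

lemma burau3_gen_relations:
  assumes "(u, v) \<in> braid_relations 3"
  shows "word_matrix (burau3_gen t) u = word_matrix (burau3_gen t) v"
proof -
  have "\<not> (1 \<le> i \<and> i + 1 < j \<and> j < 3)" for i j :: nat by arith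
  moreover have "i = 1" if "1 \<le> i" "i + 1 < 3" for i :: nat using that by arith
  ultimately have "u = [sigma 1, sigma 2, sigma 1] \<and> v = [sigma 2, sigma 1, sigma 2]"
    using assms unfolding braid_relations_def by fastforce
  then show ?thesis
    by (auto simp: burau3_gen_def matrix_entry_simps algebra_simps)
qed

lemma burau4_word_class:
  assumes "t \<noteq> 0" "w \<in> words {1..<4}"
  shows "burau4 t (word_class {1..<4} (braid_relations 4) w) = word_matrix (burau4_gen t) w"
  unfolding burau4_def
  by (intro class_matrix_word_class invertible_burau4_gen burau4_gen_relations assms)

lemma burau3_word_class:
  assumes "t \<noteq> 0" "w \<in> words {1..<3}"
  shows "burau3 t (word_class {1..<3} (braid_relations 3) w) = word_matrix (burau3_gen t) w"
  unfolding burau3_def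
  by (intro class_matrix_word_class invertible_burau3_gen burau3_gen_relations assms)

lemma burau4_hom:
  assumes "t \<noteq> 0" "X \<in> carrier (braid_group 4)" "Y \<in> carrier (braid_group 4)"
  shows "burau4 t (X \<otimes>\<^bsub>braid_group 4\<^esub> Y) = burau4 t X ** burau4 t Y"
    and "invertible (burau4 t X)"
  using assms
  by (auto simp: braid_group_def carrier_presented_group mult_word_class burau4_word_class
      append_words word_matrix_append simp del: One_nat_def intro!: word_matrix_invertible invertible_burau4_gen)

lemma burau3_hom:
  assumes "t \<noteq> 0" "X \<in> carrier (braid_group 3)" "Y \<in> carrier (braid_group 3)"
  shows "burau3 t (X \<otimes>\<^bsub>braid_group 3\<^esub> Y) = burau3 t X ** burau3 t Y"
    and "invertible (burau3 t X)"
  using assms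
  by (auto simp: braid_group_def carrier_presented_group mult_word_class burau3_word_class
      append_words word_matrix_append simp del: One_nat_def intro!: word_matrix_invertible invertible_burau3_gen)

lemma burau4_braid_gen: "t \<noteq> 0 \<Longrightarrow> i \<in> {1, 2, 3} \<Longrightarrow> burau4 t (braid_gen 4 i) = burau4_gen t i"
  unfolding braid_gen_def by (subst burau4_word_class) (auto simp: words_def)

lemma burau3_braid_gen: "t \<noteq> 0 \<Longrightarrow> i \<in> {1, 2} \<Longrightarrow> burau3 t (braid_gen 3 i) = burau3_gen t i"
  unfolding braid_gen_def by (subst burau3_word_class) (auto simp: words_def)

section \<open>Projective spaces\<close>

definition projrel :: "'a::field^'n \<Rightarrow> 'a^'n \<Rightarrow> bool" where
  "projrel u v \<longleftrightarrow> u \<noteq> 0 \<and> (\<exists>c. c \<noteq> 0 \<and> v = c *s u)"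

lemma projrel_refl: "v \<noteq> 0 \<Longrightarrow> projrel v v"
  unfolding projrel_def by (metis vector_smult_lid zero_neq_one)

lemma part_equivp_projrel: "part_equivp (projrel :: 'a::field^'n \<Rightarrow> _)"
proof (rule part_equivpI)
  have "(vec 1 :: 'a^'n) \<noteq> 0" by (simp add: vec_eq_iff)
  then show "\<exists>x :: 'a^'n. projrel x x" using projrel_refl by blast
  show "symp (projrel :: 'a^'n \<Rightarrow> _)"
  proof (rule sympI)
    fix u v :: "'a^'n" assume "projrel u v"
    then obtain c where c: "u \<noteq> 0" "c \<noteq> 0" "v = c *s u" by (auto simp: projrel_def)
    then have "v \<noteq> 0" "u = inverse c *s v" "inverse c \<noteq> 0" by (auto simp: vec_eq_iff)
    then show "projrel v u" unfolding projrel_def by blast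
  qed
  show "transp (projrel :: 'a^'n \<Rightarrow> _)"
  proof (rule transpI)
    fix u v w :: "'a^'n" assume "projrel u v" "projrel v w"
    then obtain c d where "u \<noteq> 0" "c \<noteq> 0" "v = c *s u" "d \<noteq> 0" "w = d *s v"
      by (auto simp: projrel_def)
    then have "u \<noteq> 0" "w = (d * c) *s u" "d * c \<noteq> 0" by (auto simp: vec_eq_iff)
    then show "projrel u w" unfolding projrel_def by blast
  qed
qed

text \<open>\<open>('a, 'n) proj\<close> is the projective space of lines in \<open>'a^'n\<close>; its dimension is
  \<open>CARD('n) - 1\<close>. For nonzero \<open>v\<close>, \<open>point v\<close> is the point with homogeneous coordinates \<open>v\<close>.\<close>

quotient_type (overloaded) ('a, 'n) proj = "'a::field^'n" / partial: projrel
  morphisms rep_point point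
  by (rule part_equivp_projrel)

lemma point_eq_iff:
  assumes "u \<noteq> 0" "v \<noteq> 0"
  shows "point u = point v \<longleftrightarrow> (\<exists>c. c \<noteq> 0 \<and> v = c *s u)"
  using Quotient_rel_abs[OF Quotient_proj] Quotient_rel[OF Quotient_proj, of u v]
    projrel_refl[OF assms(1)] projrel_refl[OF assms(2)] assms
  by (auto simp: projrel_def)

lemma point_exhaust: "\<exists>v. v \<noteq> 0 \<and> p = point v"
  by (induct p rule: proj.abs_induct) (auto simp: projrel_def)

text \<open>The action of a matrix by multiplication on homogeneous coordinates. It is used for
  invertible matrices only; a point whose coordinates are in the kernel is left alone.\<close>

lift_definition proj_map :: "'a::field^'n^'n \<Rightarrow> ('a, 'n) proj \<Rightarrow> ('a, 'n) proj"
  is "\<lambda>A v. if A *v v = 0 then v else A *v v"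
  by (auto simp: projrel_def vector_scalar_commute matrix_vector_mult_scaleR)

lemma proj_map_point:
  assumes "invertible A" "v \<noteq> 0"
  shows "proj_map A (point v) = point (A *v v)"
proof -
  have "A *v v \<noteq> 0"
    using assms by (metis invertible_def matrix_vector_mul_assoc matrix_vector_mul_lid
        matrix_vector_mult_0_right)
  then show ?thesis using proj_map.abs_eq[OF projrel_refl[OF assms(2)], of A] by simp
qed

lift_definition iota :: "('a::field, 2) proj \<Rightarrow> ('a, 3) proj"
  is "\<lambda>v. vector [v $ 1, v $ 2, 0]"
  by (auto simp: projrel_def vec_eq_iff forall_2 forall_3)

lemma iota_point:
  assumes "(r, s) \<noteq> (0, 0)"
  shows "iota (point (vector [r, s])) = point (vector [r, s, 0])"
proof -
  have "(vector [r, s] :: _ ^ 2) \<noteq> 0" using assms by (simp add: vec_eq_iff forall_2)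
  then show ?thesis using iota.abs_eq[OF projrel_refl] by fastforce
qed

section \<open>The quantizations of the projective line and plane\<close>

type_synonym ratfun = "int poly fract"

definition qvar :: ratfun where
  "qvar = Fract [:0, 1:] 1"

lemma qvar_nonzero: "qvar \<noteq> 0"
  by (simp add: qvar_def Zero_fract_def eq_fract)

text \<open>\<open>specializes x c\<close>: \<open>x\<close> is a Laurent polynomial with integer coefficients in the variable
  \<^const>\<open>qvar\<close>, and \<open>c\<close> is its value at \<open>1\<close>. Lemma \<open>specializes_burau4\<close> says that the
  representation \<open>burau4 qvar\<close> is defined over the Laurent polynomials and that \<open>burau4 1\<close> is its
  specialization at \<open>1\<close>.\<close>

definition specializes :: "ratfun \<Rightarrow> rat \<Rightarrow> bool" where
  "specializes x c \<longleftrightarrow> (\<exists>p k. x = Fract p (monom 1 k) \<and> c = of_int (poly p 1))"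

lemma specializes_unique: "specializes x c \<Longrightarrow> specializes x d \<Longrightarrow> c = d"
proof -
  have "poly a 1 = poly b 1"
    if "Fract a (monom 1 k) = Fract b (monom 1 l)" for a b :: "int poly" and k l
  proof -
    from that have "a * monom 1 l = b * monom 1 k" by (simp add: eq_fract)
    then have "poly (a * monom 1 l) 1 = poly (b * monom 1 k) 1" by simp
    then show ?thesis by (simp add: poly_monom)
  qed
  then show "specializes x c \<Longrightarrow> specializes x d \<Longrightarrow> c = d"
    unfolding specializes_def by metis
qed

lemma specializes_add: "specializes x c \<Longrightarrow> specializes y d \<Longrightarrow> specializes (x + y) (c + d)"
proof -
  assume "specializes x c" "specializes y d"
  then obtain a k b l where "x = Fract a (monom 1 k)" "c = of_int (poly a 1)"
    "y = Fract b (monom 1 l)" "d = of_int (poly b 1)" by (auto simp: specializes_def)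
  then have "x + y = Fract (a * monom 1 l + b * monom 1 k) (monom 1 (k + l))"
    "c + d = of_int (poly (a * monom 1 l + b * monom 1 k) 1)"
    by (simp_all add: mult_monom poly_monom)
  then show ?thesis unfolding specializes_def by blast
qed

lemma specializes_mult: "specializes x c \<Longrightarrow> specializes y d \<Longrightarrow> specializes (x * y) (c * d)"
proof -
  assume "specializes x c" "specializes y d"
  then obtain a k b l where "x = Fract a (monom 1 k)" "c = of_int (poly a 1)"
    "y = Fract b (monom 1 l)" "d = of_int (poly b 1)" by (auto simp: specializes_def)
  then have "x * y = Fract (a * b) (monom 1 (k + l))" "c * d = of_int (poly (a * b) 1)"
    by (simp_all add: mult_monom)
  then show ?thesis unfolding specializes_def by blast
qed

lemma specializes_basic:
  "specializes 0 0" "specializes 1 1" "specializes qvar 1" "specializes (- qvar) (- 1)"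
  "specializes (1 / qvar) 1" "specializes (- 1 / qvar) (- 1)"
proof -
  have I: "specializes x c" if "x = Fract p (monom 1 k)" "c = of_int (poly p 1)" for x c p k
    using that by (auto simp: specializes_def)
  have m: "[:0, 1:] = monom (1::int) 1" "1 = monom (1::int) 0" by (simp_all add: monom_Suc)
  show "specializes 0 0" by (rule I[of _ 0 0]) (simp_all add: Zero_fract_def)
  show "specializes 1 1" by (rule I[of _ 1 0]) (simp_all add: One_fract_def)
  show "specializes qvar 1" by (rule I[of _ "[:0, 1:]" 0]) (simp_all add: qvar_def)
  show "specializes (- qvar) (- 1)" by (rule I[of _ "- [:0, 1:]" 0]) (simp_all add: qvar_def)
  show "specializes (1 / qvar) 1"
    by (rule I[of _ 1 1]) (simp_all add: qvar_def One_fract_def m(1))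
  show "specializes (- 1 / qvar) (- 1)"
    by (rule I[of _ "- 1" 1]) (simp_all add: qvar_def One_fract_def m(1))
qed

lemma specializes_burau4:
  assumes "X \<in> carrier (braid_group 4)"
  shows "specializes (burau4 qvar X $ i $ j) (burau4 1 X $ i $ j)"
proof -
  have inv: "matrix_inv (burau4_gen t s) = burau4_gen_inv t s" if "t \<noteq> 0" for t :: "'a::field" and s
    by (intro matrix_inv_unique burau4_gen_inverse that)
  have "specializes (burau4_gen qvar s $ i $ j) (burau4_gen 1 s $ i $ j)" for s i j
    using exhaust_3[of i] exhaust_3[of j] specializes_basic by (auto simp: burau4_gen_def)
  moreover have "specializes (burau4_gen_inv qvar s $ i $ j) (burau4_gen_inv 1 s $ i $ j)" for s i j
    using exhaust_3[of i] exhaust_3[of j] specializes_basic by (auto simp: burau4_gen_inv_def)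
  ultimately have "specializes (word_matrix (burau4_gen qvar) w $ i $ j)
      (word_matrix (burau4_gen 1) w $ i $ j)" for w
  proof (induction w arbitrary: i j)
    case Nil
    then show ?case using specializes_basic by (simp add: mat_def)
  next
    case (Cons a w)
    then show ?case
      by (auto simp: inv qvar_nonzero matrix_matrix_mult_def sum_3
          intro!: specializes_add specializes_mult)
  qed
  then show ?thesis
    using assms by (auto simp: braid_group_def carrier_presented_group qvar_nonzero
        burau4_word_class simp del: One_nat_def)
qed

text \<open>\<open>is_quantization1 f\<close>: the map \<open>f\<close> commutes with the two actions of the braid group on three
  strands and fixes \<open>[0:1]\<close>.\<close>

definition is_quantization1 :: "((rat, 2) proj \<Rightarrow> (ratfun, 2) proj) \<Rightarrow> bool" where
  "is_quantization1 f \<longleftrightarrow>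
    (\<forall>\<beta>\<in>carrier (braid_group 3). \<forall>p.
       f (proj_map (burau3 1 \<beta>) p) = proj_map (burau3 qvar \<beta>) (f p)) \<and>
    f (point (vector [0, 1])) = point (vector [0, 1])"

definition Q1 :: "(rat, 2) proj \<Rightarrow> (ratfun, 2) proj" where
  "Q1 = (THE f. is_quantization1 f)"

text \<open>The value is the empty set outside the principal orbit, i.e. the orbit of \<open>[0:1:0]\<close>.\<close>

definition Q2 :: "(rat, 3) proj \<Rightarrow> (ratfun, 3) proj set" where
  "Q2 p =
    {proj_map (burau4 qvar \<beta>) (point (vector [0, 1, 0])) |\<beta>.
       \<beta> \<in> carrier (braid_group 4) \<and>
       proj_map (burau4 1 \<beta>) (point (vector [0, 1, 0])) = p}"

end

theory Submission
  imports Defs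
begin

text \<open>\<open>Q1\<close> is computed by the subtractive Euclidean algorithm on integer homogeneous coordinates
  \<open>[a:b]\<close>: for \<open>a, b \<ge> 0\<close> each step is undone by \<open>\<sigma>\<^sub>1\<close> or \<open>\<sigma>\<^sub>2\<inverse>\<close>, and the Garside element
  \<open>\<sigma>\<^sub>1\<sigma>\<^sub>2\<sigma>\<^sub>1\<close>, which acts by \<open>x \<mapsto> - 1 / (q x)\<close>, exchanges positive and negative points. Doing the same
  steps over the rational functions gives a well-defined map; its equivariance reduces to a few
  identities between products of Burau matrices. The Euclidean algorithm also shows that the braid
  group on three strands acts transitively, so this map is the only equivariant one, and
  \<open>Q1 (\<beta>[0:1]) = \<beta>[0:1]\<close> for every braid \<open>\<beta>\<close>. Finally, the Burau matrices of \<open>\<sigma>\<^sub>1, \<sigma>\<^sub>2\<close> on four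
  strands preserve the line \<open>[r:s:0]\<close> and act on it by those on three strands.\<close>

declare One_nat_def [simp del]

section \<open>Words of matrices acting on projective points\<close>

lemma proj_map_mult:
  assumes "invertible A" "invertible B"
  shows "proj_map (A ** B) p = proj_map A (proj_map B p)"
proof -
  obtain v where v: "v \<noteq> 0" "p = point v" using point_exhaust by blast
  have "B *v v \<noteq> 0"
    using assms(2) v(1) by (metis invertible_def matrix_vector_mul_assoc matrix_vector_mul_lid
        matrix_vector_mult_0_right)
  then show ?thesis
    by (simp add: v assms proj_map_point invertible_mult matrix_vector_mul_assoc)
qed

lemma proj_map_one:
  fixes p :: "('a::field, 'n::finite) proj"
  shows "proj_map (mat 1) p = p"
proof -
  obtain v where "v \<noteq> 0" "p = point v" using point_exhaust by blast
  moreover have "invertible (mat 1 :: 'a::field^'n^'n)"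
    by (auto simp: invertible_def intro: exI[of _ "mat 1"])
  ultimately show ?thesis by (simp add: proj_map_point)
qed

lemma proj_map_inv:
  assumes "invertible A"
  shows "proj_map A (proj_map (matrix_inv A) p) = p" "proj_map (matrix_inv A) (proj_map A p) = p"
  using assms by (simp_all flip: proj_map_mult add: invertible_matrix_inv matrix_inv_mult proj_map_one)

text \<open>Generators act bijectively on both sides, so equivariance passes to their inverses and
  then letter by letter to words. Source and target may differ in field and dimension, as needed for
  both \<open>q_point\<close> and \<open>iota\<close>.\<close>

lemma intertwines_word_matrix:
  assumes "\<And>s. s \<in> S \<Longrightarrow> invertible (G s)" "\<And>s. s \<in> S \<Longrightarrow> invertible (G' s)"
    and gen: "\<And>s p. s \<in> S \<Longrightarrow> f (proj_map (G s) p) = proj_map (G' s) (f p)"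
    and "w \<in> words S"
  shows "f (proj_map (word_matrix G w) p) = proj_map (word_matrix G' w) (f p)"
  using assms(4)
proof (induction w)
  case Nil
  then show ?case by (simp add: proj_map_one)
next
  case (Cons a w)
  then have s: "fst a \<in> S" and w: "w \<in> words S" by (auto simp: words_def)
  have inv: "f (proj_map (matrix_inv (G (fst a))) p) = proj_map (matrix_inv (G' (fst a))) (f p)" for p
    \<comment> \<open>Equivariance at the preimage of \<open>p\<close>, followed by cancelling
      \<open>G' (fst a)\<close>.\<close>
    using gen[OF s, of "proj_map (matrix_inv (G (fst a))) p"]
    by (simp add: proj_map_inv assms(1,2) s)
  show ?case
    using Cons.IH[OF w]
    by (simp add: proj_map_mult assms(1,2) s w invertible_matrix_inv inv gen
        word_matrix_invertible[of S])
qed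

section \<open>The braid group on three strands acts transitively on the rational line\<close>

definition int_point :: "int \<Rightarrow> int \<Rightarrow> (rat, 2) proj" where
  "int_point a b = point (vector [of_int a, of_int b])"

lemma vector2_nonzero: "(vector [r, s] :: 'a::zero^2) \<noteq> 0 \<longleftrightarrow> r \<noteq> 0 \<or> s \<noteq> 0"
  by (simp add: vec_eq_iff forall_2)

lemma point2_eqI:
  fixes r s r' s' :: "'a::field"
  assumes "r' \<noteq> 0 \<or> s' \<noteq> 0" "c \<noteq> 0" "r = c * r'" "s = c * s'"
  shows "point (vector [r, s] :: 'a^2) = point (vector [r', s'])"
proof -
  have "point (vector [r', s']) = point (vector [r, s] :: 'a^2)"
    using assms by (subst point_eq_iff) (auto simp: vec_eq_iff forall_2 intro!: exI[of _ c])
  then show ?thesis by simp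
qed

lemma int_point_exhaust:
  obtains a b where "a \<noteq> 0 \<or> b \<noteq> 0" "p = int_point a b"
proof -
  obtain v where v: "v \<noteq> 0" "p = point v" using point_exhaust by blast
  obtain a d where ad: "v $ 1 = of_int a / of_int d" "d > 0"
    using quotient_of_div quotient_of_denom_pos by (metis surj_pair)
  obtain b e where be: "v $ 2 = of_int b / of_int e" "e > 0"
    using quotient_of_div quotient_of_denom_pos by (metis surj_pair)
  have vv: "v = vector [v $ 1, v $ 2]" by (simp add: vec_eq_iff forall_2)
  have nz: "v $ 1 \<noteq> 0 \<or> v $ 2 \<noteq> 0" using v(1) by (simp add: vec_eq_iff forall_2)
  \<comment> \<open>Scaling \<open>(a / d, b / e)\<close> by \<open>d * e\<close> clears both
    denominators.\<close>
  have "int_point (a * e) (b * d) = point (vector [v $ 1, v $ 2])"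
    unfolding int_point_def
    by (rule point2_eqI[where c = "of_int (d * e)"]) (use nz ad be in auto)
  moreover have "a * e \<noteq> 0 \<or> b * d \<noteq> 0" using nz ad be by auto
  ultimately show thesis using that vv v(2) by metis
qed

lemma int_point_eqD:
  assumes "int_point a b = int_point c d" "a \<noteq> 0 \<or> b \<noteq> 0" "c \<noteq> 0 \<or> d \<noteq> 0"
  shows "a * d = b * c"
proof -
  obtain k where "(of_int c :: rat) = k * of_int a" "(of_int d :: rat) = k * of_int b"
    using assms unfolding int_point_def
    by (subst (asm) point_eq_iff) (auto simp: vec_eq_iff forall_2)
  then have "(of_int (a * d) :: rat) = of_int (b * c)" by simp
  then show ?thesis by (simp only: of_int_eq_iff)
qed

lemma int_point_uminus:
  assumes "a \<noteq> 0 \<or> b \<noteq> 0"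
  shows "int_point (- a) (- b) = int_point a b"
  unfolding int_point_def by (rule point2_eqI[where c = "-1"]) (use assms in auto)

lemma burau3_gen_mult_vector:
  "burau3_gen t 1 *v vector [r, s] = vector [t * r + s, s]"
  "burau3_gen t 2 *v vector [r, s] = vector [r, t * (s - r)]"
  by (simp_all add: burau3_gen_def matrix_vector_mult_def vec_eq_iff forall_2 sum_2 algebra_simps)

lemma burau3_int_point:
  assumes "a \<noteq> 0 \<or> b \<noteq> 0"
  shows "proj_map (burau3_gen 1 1) (int_point a b) = int_point (a + b) b"
    and "proj_map (burau3_gen 1 2) (int_point a b) = int_point a (b - a)"
  using assms unfolding int_point_def
  by (simp_all add: proj_map_point invertible_burau3_gen vector2_nonzero burau3_gen_mult_vector)

text \<open>Indexed by words rather than braids, so that acting by a generator or its inverse just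
  prepends a letter.\<close>

definition orbit3 :: "(rat, 2) proj set" where
  "orbit3 = (\<lambda>w. proj_map (word_matrix (burau3_gen 1) w) (int_point 0 1)) ` words {1..<3}"

lemma proj_map_orbit3:
  assumes "s \<in> {1, 2}"
  shows "proj_map (burau3_gen 1 s) p \<in> orbit3 \<longleftrightarrow> p \<in> orbit3"
proof -
  have inv: "invertible (word_matrix (burau3_gen (1::rat)) w)" if "w \<in> words {1..<3}" for w
    by (rule word_matrix_invertible[OF invertible_burau3_gen that]) simp
  have "proj_map (burau3_gen 1 s) p \<in> orbit3" if "p \<in> orbit3" for p
  proof -
    obtain w where w: "w \<in> words {1..<3}" "p = proj_map (word_matrix (burau3_gen 1) w) (int_point 0 1)"
      using \<open>p \<in> orbit3\<close> unfolding orbit3_def by blast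
    have "(s, True) # w \<in> words {1..<3}" using w assms by (auto simp: words_def)
    moreover have "proj_map (burau3_gen 1 s) p =
        proj_map (word_matrix (burau3_gen 1) ((s, True) # w)) (int_point 0 1)"
      using w by (simp add: inv proj_map_mult invertible_burau3_gen)
    ultimately show ?thesis unfolding orbit3_def by blast
  qed
  \<comment> \<open>Stability under the inverse, applied to the image of \<open>p\<close>, yields
    the converse implication.\<close>
  moreover have "proj_map (matrix_inv (burau3_gen 1 s)) p \<in> orbit3" if "p \<in> orbit3" for p
  proof -
    obtain w where w: "w \<in> words {1..<3}" "p = proj_map (word_matrix (burau3_gen 1) w) (int_point 0 1)"
      using \<open>p \<in> orbit3\<close> unfolding orbit3_def by blast
    have "(s, False) # w \<in> words {1..<3}" using w assms by (auto simp: words_def)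
    moreover have "proj_map (matrix_inv (burau3_gen 1 s)) p =
        proj_map (word_matrix (burau3_gen 1) ((s, False) # w)) (int_point 0 1)"
      using w by (simp add: inv proj_map_mult invertible_burau3_gen invertible_matrix_inv)
    ultimately show ?thesis unfolding orbit3_def by blast
  qed
  ultimately show ?thesis
    by (metis proj_map_inv(2) invertible_burau3_gen zero_neq_one)
qed

lemma int_point_orbit3_iff:
  assumes "a \<noteq> 0 \<or> b \<noteq> 0"
  shows "int_point (a + b) b \<in> orbit3 \<longleftrightarrow> int_point a b \<in> orbit3"
    and "int_point a (b - a) \<in> orbit3 \<longleftrightarrow> int_point a b \<in> orbit3"
  using proj_map_orbit3[of 1 "int_point a b"] proj_map_orbit3[of 2 "int_point a b"]
  by (simp_all only: burau3_int_point[OF assms]) simp_all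

text \<open>Signed Euclidean descent: the entry of larger absolute value is replaced by the
  difference if the signs agree and by the sum if they differ. This lowers
  \<open>\<bar>a\<bar> + \<bar>b\<bar>\<close> until an entry vanishes.\<close>

lemma int_point_orbit3:
  assumes "a \<noteq> 0 \<or> b \<noteq> 0"
  shows "int_point a b \<in> orbit3"
  using assms
proof (induction "nat (\<bar>a\<bar> + \<bar>b\<bar>)" arbitrary: a b rule: less_induct)
  case less
  have zero: "int_point 0 b \<in> orbit3" if "b \<noteq> 0" for b
  proof -
    have "int_point 0 b = int_point 0 1"
      unfolding int_point_def by (rule point2_eqI[where c = "of_int b"]) (use that in auto)
    moreover have "int_point 0 1 \<in> orbit3"
      unfolding orbit3_def by (rule image_eqI[where x = "[]"]) (simp_all add: proj_map_one Nil_words)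
    ultimately show ?thesis by simp
  qed
  note up1 = int_point_orbit3_iff(1) and up2 = int_point_orbit3_iff(2)
  consider "a = 0" | "b = 0" "a \<noteq> 0" | "a * b > 0" "\<bar>b\<bar> \<le> \<bar>a\<bar>" | "a * b > 0" "\<bar>a\<bar> < \<bar>b\<bar>"
    | "a * b < 0" "\<bar>b\<bar> \<le> \<bar>a\<bar>" | "a * b < 0" "\<bar>a\<bar> < \<bar>b\<bar>"
    using less.prems by (metis linorder_neqE_linordered_idom linorder_not_le mult_eq_0_iff)
  then show ?case
  proof cases
    case 1
    then show ?thesis using zero less.prems by simp
  next
    case 2
    \<comment> \<open>\<open>[a:0]\<close> is reached from \<open>[0:a]\<close> through
      \<open>[a:a]\<close>.\<close>
    then show ?thesis using zero[of a] up1[of 0 a] up2[of a a] by simp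
  next
    case 3
    then have "\<bar>a - b\<bar> < \<bar>a\<bar>" "b \<noteq> 0" by (auto simp: zero_less_mult_iff)
    then show ?thesis using less.hyps[of "a - b" b] up1[of "a - b" b] by simp
  next
    case 4
    then have "\<bar>b - a\<bar> < \<bar>b\<bar>" "a \<noteq> 0" by (auto simp: zero_less_mult_iff)
    then show ?thesis using less.hyps[of a "b - a"] up2[of a b] by simp
  next
    case 5
    then have "\<bar>a + b\<bar> < \<bar>a\<bar>" "b \<noteq> 0" by (auto simp: mult_less_0_iff)
    then show ?thesis using less.hyps[of "a + b" b] up1[of a b] by simp
  next
    case 6
    then have "\<bar>a + b\<bar> < \<bar>b\<bar>" "a \<noteq> 0" by (auto simp: mult_less_0_iff)
    then show ?thesis using less.hyps[of a "a + b"] up2[of a "a + b"] by simp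
  qed
qed

lemma orbit3_UNIV: "p \<in> orbit3"
  by (metis int_point_exhaust int_point_orbit3)

section \<open>Existence and uniqueness of the quantization of the line\<close>

definition garside3 :: "'a::field \<Rightarrow> 'a^2^2" where
  "garside3 t = burau3_gen t 1 ** burau3_gen t 2 ** burau3_gen t 1"

abbreviation sigma1_map :: "'a::field \<Rightarrow> ('a, 2) proj \<Rightarrow> ('a, 2) proj" where
  "sigma1_map t \<equiv> proj_map (burau3_gen t 1)"

text \<open>The inverse is the useful direction: at \<open>t = 1\<close> it sends
  \<open>[a:b]\<close> to \<open>[a:a+b]\<close> and so preserves nonnegative coordinates.\<close>

abbreviation sigma2_inv_map :: "'a::field \<Rightarrow> ('a, 2) proj \<Rightarrow> ('a, 2) proj" where
  "sigma2_inv_map t \<equiv> proj_map (matrix_inv (burau3_gen t 2))"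

abbreviation garside3_map :: "'a::field \<Rightarrow> ('a, 2) proj \<Rightarrow> ('a, 2) proj" where
  "garside3_map t \<equiv> proj_map (garside3 t)"

lemma matrix_inv_burau3_gen: "t \<noteq> 0 \<Longrightarrow> matrix_inv (burau3_gen t s) = burau3_gen_inv t s"
  by (intro matrix_inv_unique burau3_gen_inverse)

lemma invertible_garside3: "t \<noteq> 0 \<Longrightarrow> invertible (garside3 t)"
  unfolding garside3_def by (intro invertible_mult invertible_burau3_gen)

lemma garside3_mult_vector: "garside3 t *v vector [r, s] = vector [t * s, - (t ^ 2 * r)]"
  by (simp add: garside3_def burau3_gen_mult_vector power2_eq_square algebra_simps flip: matrix_vector_mul_assoc)

lemma burau3_gen_inv_mult_vector:
  "burau3_gen_inv t 2 *v vector [r, s] = vector [r, r + s / t]"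
  by (simp add: burau3_gen_inv_def matrix_vector_mult_def vec_eq_iff forall_2 sum_2)

lemma proj_maps_point:
  assumes "t \<noteq> 0" "r \<noteq> 0 \<or> s \<noteq> 0"
  shows "sigma1_map t (point (vector [r, s])) = point (vector [t * r + s, s])"
    and "sigma2_inv_map t (point (vector [r, s])) = point (vector [r, r + s / t])"
    and "garside3_map t (point (vector [r, s])) = point (vector [t * s, - (t ^ 2 * r)])"
  using assms invertible_matrix_inv[OF invertible_burau3_gen[OF assms(1)], of 2]
  by (simp_all add: proj_map_point invertible_burau3_gen invertible_garside3 garside3_mult_vector
      matrix_inv_burau3_gen vector2_nonzero burau3_gen_mult_vector burau3_gen_inv_mult_vector)

lemma point2_exhaust:
  fixes p :: "('a::field, 2) proj"
  obtains r s where "r \<noteq> 0 \<or> s \<noteq> 0" "p = point (vector [r, s])"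
proof -
  obtain v where v: "v \<noteq> 0" "p = point v" using point_exhaust by blast
  have "v = vector [v $ 1, v $ 2]" by (simp add: vec_eq_iff forall_2)
  then show thesis using that v vector2_nonzero by metis
qed

text \<open>Conjugation by the half twist exchanges sigma1 and sigma2, whence the first three; the
  fourth also uses that its square acts by a scalar. They tell how a Euclidean step passes through
  \<open>garside3_map\<close>, that is, through a change of sign.\<close>

lemma garside3_identities:
  assumes t: "t \<noteq> 0"
  shows "sigma2_inv_map t (garside3_map t (sigma2_inv_map t p)) = sigma1_map t p" (is ?A)
    and "sigma2_inv_map t (garside3_map t (sigma1_map t p)) = garside3_map t p" (is ?B)
    and "sigma1_map t (garside3_map t (sigma2_inv_map t p)) = garside3_map t p" (is ?C)
    and "sigma1_map t (garside3_map t (sigma1_map t p)) = sigma2_inv_map t p" (is ?D)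
proof -
  obtain r s where p: "r \<noteq> 0 \<or> s \<noteq> 0" "p = point (vector [r, s])" by (rule point2_exhaust)
  \<comment> \<open>The intermediate vectors of all four composites are nonzero, so the coordinate
    formulas apply to each.\<close>
  have nz: "r \<noteq> 0 \<or> r + s / t \<noteq> 0" "t * r + s \<noteq> 0 \<or> s \<noteq> 0"
    "t * (r + s / t) \<noteq> 0 \<or> - (t ^ 2 * r) \<noteq> 0" "t * s \<noteq> 0 \<or> - (t ^ 2 * (t * r + s)) \<noteq> 0"
    using p t by auto
  note maps = proj_maps_point[OF t p(1)] proj_maps_point[OF t nz(1)] proj_maps_point[OF t nz(2)]
    proj_maps_point[OF t nz(3)] proj_maps_point[OF t nz(4)]
  show ?A
    unfolding p(2) maps
    by (rule point2_eqI[where c = 1], use p nz t in \<open>auto simp: field_simps power2_eq_square\<close>)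
  show ?B
    unfolding p(2) maps
    by (rule point2_eqI[where c = 1], use p nz t in \<open>auto simp: field_simps power2_eq_square\<close>)
  show ?C
    unfolding p(2) maps
    by (rule point2_eqI[where c = 1], use p nz t in \<open>auto simp: field_simps power2_eq_square\<close>)
  show ?D
    unfolding p(2) maps
    \<comment> \<open>This scalar is the square of the matrix \<open>garside3 t\<close>.\<close>
    by (rule point2_eqI[where c = "- (t ^ 3)"],
        use p nz t in \<open>auto simp: field_simps power2_eq_square power3_eq_cube\<close>)
qed

section \<open>The deformed Euclidean algorithm on nonnegative pairs\<close>

text \<open>For \<open>t = qvar\<close> this is the q-rational of \<open>a / b\<close>: sigma1 is
  \<open>x \<mapsto> q x + 1\<close> and the inverse of sigma2 is
  \<open>x \<mapsto> q x / (q x + 1)\<close>. The pair \<open>(0, 0)\<close> gets the default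
  \<open>[1:0]\<close>, and ties \<open>a = b\<close> go to sigma1.\<close>

function q_euclid :: "'a::field \<Rightarrow> nat \<Rightarrow> nat \<Rightarrow> ('a, 2) proj" where
  "q_euclid t a b =
    (if b = 0 then point (vector [1, 0])
     else if a = 0 then point (vector [0, 1])
     else if b \<le> a then sigma1_map t (q_euclid t (a - b) b)
     else sigma2_inv_map t (q_euclid t a (b - a)))"
  by auto
termination by (relation "Wellfounded.measure (\<lambda>(t, a, b). a + b)") auto

declare q_euclid.simps [simp del]

lemma q_euclid_zero:
  "q_euclid t a 0 = point (vector [1, 0])" "b > 0 \<Longrightarrow> q_euclid t 0 b = point (vector [0, 1])"
  by (simp_all add: q_euclid.simps)

lemma q_euclid_add:
  assumes "t \<noteq> 0"
  shows "b > 0 \<Longrightarrow> q_euclid t (a + b) b = sigma1_map t (q_euclid t a b)"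
    and "a > 0 \<Longrightarrow> q_euclid t a (a + b) = sigma2_inv_map t (q_euclid t a b)"
proof -
  show *: "q_euclid t (a + b) b = sigma1_map t (q_euclid t a b)" if "b > 0" for a b
    using that by (simp add: q_euclid.simps[of t "a + b"])
  show "q_euclid t a (a + b) = sigma2_inv_map t (q_euclid t a b)" if "a > 0"
  proof (cases "b = 0")
    \<comment> \<open>For \<open>b = 0\<close> the pair is a tie, which the recursion resolves by
      sigma1; this agrees because \<open>[0:1]\<close> under sigma1 and \<open>[1:0]\<close> under
      the inverse of sigma2 both give \<open>[1:1]\<close>.\<close>
    case True
    then show ?thesis
      using *[of a 0] that assms by (simp add: q_euclid_zero proj_maps_point)
  next
    case False
    then show ?thesis using that by (simp add: q_euclid.simps[of t a "a + b"])
  qed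
qed

text \<open>Proportional pairs take the same branch, and subtraction keeps them proportional, so the
  two computations run in parallel.\<close>

lemma q_euclid_ratio:
  assumes "a * d = b * c" "a > 0 \<or> b > 0" "c > 0 \<or> d > 0"
  shows "q_euclid t a b = q_euclid t c d"
  using assms
proof (induction t a b arbitrary: c d rule: q_euclid.induct)
  case (1 t a b)
  consider "b = 0" | "a = 0" "b > 0" | "0 < b" "b \<le> a" | "0 < a" "a < b" by linarith
  then show ?case
  proof cases
    case 1
    then show ?thesis using "1.prems" by (simp add: q_euclid_zero)
  next
    case 2
    then show ?thesis using "1.prems" by (simp add: q_euclid_zero)
  next
    case 3
    then have "d > 0" using "1.prems" by (metis gr0I mult_0_right mult_eq_0_iff not_less0 le_zero_eq)
    moreover have "d \<le> c"
      using 3 "1.prems"(1) by (metis mult_le_mono1 mult_le_cancel1)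
    moreover have "(a - b) * d = b * (c - d)"
      using "1.prems"(1) by (simp add: diff_mult_distrib diff_mult_distrib2)
    ultimately show ?thesis
      using 3 "1.IH"(1)[of d "c - d"] "1.prems"
      by (simp add: q_euclid.simps[of t a] q_euclid.simps[of t c])
  next
    case 4
    then have "c > 0" using "1.prems" by (metis gr0I mult_0_right mult_eq_0_iff not_less0)
    moreover have "c < d"
    proof (rule ccontr)
      assume "\<not> c < d"
      then have "a * d \<le> a * c" by simp
      also have "\<dots> < b * c" using 4 \<open>c > 0\<close> by simp
      finally show False using "1.prems"(1) by simp
    qed
    moreover have "a * (d - c) = (b - a) * c"
      using "1.prems"(1) by (simp add: diff_mult_distrib diff_mult_distrib2)
    ultimately show ?thesis
      using 4 "1.IH"(2)[of "d - c" c] "1.prems"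
      by (simp add: q_euclid.simps[of t a] q_euclid.simps[of t c])
  qed
qed

section \<open>Extension to signed coordinates and equivariance\<close>

text \<open>At \<open>t = 1\<close> the half twist is \<open>x \<mapsto> - 1 / x\<close>, so a
  negative point comes from the positive one with swapped coordinates. Points with a zero coordinate
  fall in the first branch.\<close>

definition q_int_point :: "'a::field \<Rightarrow> int \<Rightarrow> int \<Rightarrow> ('a, 2) proj" where
  "q_int_point t a b =
    (if a * b \<ge> 0 then q_euclid t (nat \<bar>a\<bar>) (nat \<bar>b\<bar>)
     else garside3_map t (q_euclid t (nat \<bar>b\<bar>) (nat \<bar>a\<bar>)))"

lemma q_int_point_uminus: "q_int_point t (- a) (- b) = q_int_point t a b"
  by (simp add: q_int_point_def)

lemma q_int_point_nonneg: "q_int_point t (int m) (int n) = q_euclid t m n"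
  by (simp add: q_int_point_def)

lemma q_int_point_neg:
  assumes "m > 0" "n > 0"
  shows "q_int_point t (- int m) (int n) = garside3_map t (q_euclid t n m)"
    and "q_int_point t (int m) (- int n) = garside3_map t (q_euclid t n m)"
  using assms by (simp_all add: q_int_point_def mult_le_0_iff)

lemma q_int_point_ratio:
  assumes "a * d = b * c" "a \<noteq> 0 \<or> b \<noteq> 0" "c \<noteq> 0 \<or> d \<noteq> 0"
  shows "q_int_point t a b = q_int_point t c d"
proof -
  have abs: "nat \<bar>a\<bar> * nat \<bar>d\<bar> = nat \<bar>b\<bar> * nat \<bar>c\<bar>"
    using assms(1) by (metis abs_mult nat_mult_distrib abs_ge_zero)
  \<comment> \<open>Up to square factors the products \<open>a * b\<close> and \<open>c * d\<close>
    agree, so both pairs take the same branch of \<open>q_int_point\<close>.\<close>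
  have "(a * b) * (d * d) = (c * d) * (b * b)" "(c * d) * (a * a) = (a * b) * (c * c)"
    using assms(1) by algebra+
  moreover have "b * b > 0 \<or> a * a > 0" "d * d > 0 \<or> c * c > 0"
    using assms(2,3) by (auto simp: zero_less_mult_iff)
  ultimately have "a * b \<ge> 0 \<longleftrightarrow> c * d \<ge> 0"
    using assms by (smt (verit) mult_eq_0_iff zero_le_mult_iff)
  moreover have "q_euclid t (nat \<bar>a\<bar>) (nat \<bar>b\<bar>) = q_euclid t (nat \<bar>c\<bar>) (nat \<bar>d\<bar>)"
    "q_euclid t (nat \<bar>b\<bar>) (nat \<bar>a\<bar>) = q_euclid t (nat \<bar>d\<bar>) (nat \<bar>c\<bar>)"
    using assms abs by (auto intro!: q_euclid_ratio simp: mult.commute)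
  ultimately show ?thesis by (simp add: q_int_point_def)
qed

text \<open>Negating both coordinates reduces to \<open>b \<ge> 0\<close>. For
  \<open>a \<ge> 0\<close> and \<open>b > 0\<close> this is a Euclidean step; for
  \<open>a < 0 < b\<close> the sign of \<open>a + b\<close> decides which identity of the half twist
  is used.\<close>

lemma q_int_point_sigma1:
  assumes t: "t \<noteq> 0" and "a \<noteq> 0 \<or> b \<noteq> 0"
  shows "q_int_point t (a + b) b = sigma1_map t (q_int_point t a b)"
proof -
  have pos: "q_int_point t (a + int n) (int n) = sigma1_map t (q_int_point t a (int n))"
    if n: "n > 0" for a n
  proof (cases "a \<ge> 0")
    case True
    then obtain m where "a = int m" by (metis nonneg_int_cases)
    then show ?thesis
      using n t by (metis of_nat_add q_int_point_nonneg q_euclid_add(1))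
  next
    case False
    then obtain m where m: "a = - int m" "m > 0"
      by (metis int_cases2 neg_0_less_iff_less of_nat_0_less_iff not_le minus_minus of_nat_0_le_iff)
    consider "m < n" | "m = n" | "n < m" by linarith
    then show ?thesis
    proof cases
      \<comment> \<open>The sum becomes positive; the fourth identity removes the half
        twist.\<close>
      case 1
      define k where "k = n - m"
      with 1 have k: "n = k + m" "k > 0" by auto
      have "q_int_point t (a + int n) (int n) = q_euclid t k (k + m)"
        using q_int_point_nonneg[of t k "k + m"] by (simp add: m k)
      also have "\<dots> = sigma2_inv_map t (q_euclid t k m)"
        using q_euclid_add(2)[OF t] k by simp
      also have "\<dots> = sigma1_map t (garside3_map t (q_euclid t n m))"
        using garside3_identities(4)[OF t] q_euclid_add(1)[OF t] k m by simp
      finally show ?thesis using q_int_point_neg(1) m n by metis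
    next
      \<comment> \<open>The point -1 moves to 0: again the fourth identity, now at
        \<open>[0:1]\<close>, which the inverse of sigma2 fixes.\<close>
      case 2
      have "q_euclid t n n = sigma1_map t (q_euclid t 0 n)"
        using q_euclid_add(1)[OF t, of n 0] n by simp
      then have "sigma1_map t (garside3_map t (q_euclid t n n)) = sigma2_inv_map t (q_euclid t 0 n)"
        using garside3_identities(4)[OF t] by simp
      also have "\<dots> = point (vector [0, 1])"
        using n t by (simp add: q_euclid_zero proj_maps_point)
          (rule point2_eqI[where c = "1 / t"], auto)
      finally have "sigma1_map t (garside3_map t (q_euclid t n n)) = q_euclid t 0 n"
        using n by (simp add: q_euclid_zero)
      moreover have "q_int_point t (a + int n) (int n) = q_euclid t 0 n"
        using q_int_point_nonneg[of t 0 n] by (simp add: m 2)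
      ultimately show ?thesis using q_int_point_neg(1)[of n n t] m n 2 by simp
    next
      \<comment> \<open>The sum stays negative; the third identity absorbs a sigma2-inverse step
        into the half twist.\<close>
      case 3
      define k where "k = m - n"
      with 3 have k: "m = n + k" "k > 0" by auto
      have "q_int_point t (a + int n) (int n) = garside3_map t (q_euclid t n k)"
        using q_int_point_neg(1)[OF k(2) n, of t] by (simp add: m k)
      also have "\<dots> = sigma1_map t (garside3_map t (q_euclid t n m))"
        using garside3_identities(3)[OF t] q_euclid_add(2)[OF t] k n by simp
      finally show ?thesis using q_int_point_neg(1)[OF m(2) n, of t] m by simp
    qed
  qed
  consider "b = 0" | n where "n > 0" "b = int n" | n where "n > 0" "b = - int n"
    by (metis int_cases3 of_nat_0_less_iff)
  then show ?thesis
  proof cases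
    case 1
    have "sigma1_map t (point (vector [1, 0])) = point (vector [1, 0])"
      using t by (simp add: proj_maps_point) (rule point2_eqI[where c = t], auto)
    then show ?thesis by (simp add: 1 q_int_point_def q_euclid_zero)
  next
    case (2 n)
    then show ?thesis using pos by simp
  next
    case (3 n)
    then show ?thesis
      using pos[of n "- a"] q_int_point_uminus[of t "a + b" b] q_int_point_uminus[of t a b] by simp
  qed
qed

text \<open>Mirror image of the case of sigma1, with the sign of \<open>a\<close> normalized
  instead: the first identity handles a sum \<open>a + b\<close> that turns positive, the second one
  that is zero or stays negative.\<close>

lemma q_int_point_sigma2_inv:
  assumes t: "t \<noteq> 0" and "a \<noteq> 0 \<or> b \<noteq> 0"
  shows "q_int_point t a (a + b) = sigma2_inv_map t (q_int_point t a b)"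
proof -
  have pos: "q_int_point t (int m) (int m + b) = sigma2_inv_map t (q_int_point t (int m) b)"
    if m: "m > 0" for m b
  proof (cases "b \<ge> 0")
    case True
    then obtain n where "b = int n" by (metis nonneg_int_cases)
    then show ?thesis
      using m t by (metis of_nat_add q_int_point_nonneg q_euclid_add(2))
  next
    case False
    then obtain n where n: "b = - int n" "n > 0"
      by (metis int_cases2 neg_0_less_iff_less of_nat_0_less_iff not_le minus_minus of_nat_0_le_iff)
    consider "n < m" | "m = n" | "m < n" by linarith
    then show ?thesis
    proof cases
      case 1
      define k where "k = m - n"
      with 1 have k: "m = n + k" "k > 0" by auto
      have "q_int_point t (int m) (int m + b) = q_euclid t (n + k) k"
        using q_int_point_nonneg[of t "n + k" k] by (simp add: n k)
      also have "\<dots> = sigma1_map t (q_euclid t n k)"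
        using q_euclid_add(1)[OF t] k by simp
      also have "\<dots> = sigma2_inv_map t (garside3_map t (q_euclid t n m))"
        using garside3_identities(1)[OF t] q_euclid_add(2)[OF t] k n by simp
      finally show ?thesis using q_int_point_neg(2) m n by metis
    next
      case 2
      have "q_euclid t m m = sigma1_map t (q_euclid t 0 m)"
        using q_euclid_add(1)[OF t, of m 0] m by simp
      then have "sigma2_inv_map t (garside3_map t (q_euclid t m m)) = garside3_map t (q_euclid t 0 m)"
        using garside3_identities(2)[OF t] by simp
      also have "\<dots> = point (vector [1, 0])"
        using m t by (simp add: q_euclid_zero proj_maps_point)
          (rule point2_eqI[where c = t], auto)
      finally have "sigma2_inv_map t (garside3_map t (q_euclid t m m)) = q_euclid t m 0"
        by (simp add: q_euclid_zero)
      moreover have "q_int_point t (int m) (int m + b) = q_euclid t m 0"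
        using q_int_point_nonneg[of t m 0] by (simp add: n 2)
      ultimately show ?thesis using q_int_point_neg(2)[of m m t] m n 2 by simp
    next
      case 3
      define k where "k = n - m"
      with 3 have k: "n = k + m" "k > 0" by auto
      have "q_int_point t (int m) (int m + b) = garside3_map t (q_euclid t k m)"
        using q_int_point_neg(2)[OF m k(2), of t] by (simp add: n k)
      also have "\<dots> = sigma2_inv_map t (garside3_map t (q_euclid t n m))"
        using garside3_identities(2)[OF t] q_euclid_add(1)[OF t] k m by simp
      finally show ?thesis using q_int_point_neg(2)[OF m n(2), of t] n by simp
    qed
  qed
  consider "a = 0" | m where "m > 0" "a = int m" | m where "m > 0" "a = - int m"
    by (metis int_cases3 of_nat_0_less_iff)
  then show ?thesis
  proof cases
    case 1
    have "sigma2_inv_map t (point (vector [0, 1])) = point (vector [0, 1])"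
      using t by (simp add: proj_maps_point) (rule point2_eqI[where c = "1 / t"], auto)
    then show ?thesis using assms by (simp add: 1 q_int_point_def q_euclid_zero)
  next
    case (2 m)
    then show ?thesis using pos by simp
  next
    case (3 m)
    then show ?thesis
      using pos[of m "- b"] q_int_point_uminus[of t a "a + b"] q_int_point_uminus[of t a b]
      by simp
  qed
qed

section \<open>Descent to rational points and uniqueness\<close>

text \<open>By \<open>q_int_point_ratio\<close> the choice ranges over a single value, whatever
  integral coordinates represent \<open>p\<close>.\<close>

definition q_point :: "'a::field \<Rightarrow> (rat, 2) proj \<Rightarrow> ('a, 2) proj" where
  "q_point t p = (SOME x. \<exists>a b. (a \<noteq> 0 \<or> b \<noteq> 0) \<and> p = int_point a b \<and> x = q_int_point t a b)"

lemma q_point_int_point: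
  assumes "a \<noteq> 0 \<or> b \<noteq> 0"
  shows "q_point t (int_point a b) = q_int_point t a b"
  unfolding q_point_def
proof (rule some_equality)
  fix x assume "\<exists>c d. (c \<noteq> 0 \<or> d \<noteq> 0) \<and> int_point a b = int_point c d \<and> x = q_int_point t c d"
  then show "x = q_int_point t a b"
    using int_point_eqD q_int_point_ratio assms by metis
qed (use assms in blast)

lemma q_point_burau3_gen:
  assumes t: "t \<noteq> 0" and s: "s \<in> {1..<3}"
  shows "q_point t (proj_map (burau3_gen 1 s) p) = proj_map (burau3_gen t s) (q_point t p)"
proof (rule int_point_exhaust[of p])
  fix a b assume nz: "a \<noteq> 0 \<or> b \<noteq> 0" and p: "p = int_point a b"
  consider "s = 1" | "s = 2" using s by fastforce
  then show ?thesis
  proof cases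
    case 1
    have "a + b \<noteq> 0 \<or> b \<noteq> 0" using nz by auto
    then show ?thesis
      using burau3_int_point(1)[OF nz] q_int_point_sigma1[OF t nz]
      by (simp only: 1 p q_point_int_point nz)
  next
    case 2
    \<comment> \<open>The step for the inverse of sigma2 is applied at \<open>[a:b-a]\<close>, the
      image of \<open>[a:b]\<close> under sigma2 at \<open>t = 1\<close>, and then inverted.\<close>
    have nz': "a \<noteq> 0 \<or> b - a \<noteq> 0" using nz by auto
    have "q_int_point t a b = sigma2_inv_map t (q_int_point t a (b - a))"
      using q_int_point_sigma2_inv[OF t nz'] by simp
    then show ?thesis
      using burau3_int_point(2)[OF nz]
      by (simp only: 2 p q_point_int_point nz nz' proj_map_inv invertible_burau3_gen t
          not_False_eq_True)
  qed
qed

lemma carrier_braid_group: "carrier (braid_group n) =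
    word_class {1..<n} (braid_relations n) ` words {1..<n}"
  by (simp add: braid_group_def carrier_presented_group)

lemma is_quantization1_q_point: "is_quantization1 (q_point qvar)"
proof -
  have "q_point qvar (proj_map (word_matrix (burau3_gen 1) w) p) =
      proj_map (word_matrix (burau3_gen qvar) w) (q_point qvar p)" if "w \<in> words {1..<3}" for w p
    by (rule intertwines_word_matrix[OF _ _ _ that])
      (simp_all only: q_point_burau3_gen qvar_nonzero invertible_burau3_gen zero_neq_one[symmetric]
        not_False_eq_True)
  moreover have "q_point qvar (point (vector [0, 1])) = point (vector [0, 1])"
    using q_point_int_point[of 0 1 qvar]
    by (simp add: int_point_def q_int_point_def q_euclid_zero)
  ultimately show ?thesis
    by (auto simp: is_quantization1_def carrier_braid_group burau3_word_class qvar_nonzero)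
qed

text \<open>Equivariance and the value at \<open>[0:1]\<close> force \<open>f\<close> on the whole
  orbit; this gives uniqueness and also evaluates \<open>Q1\<close>.\<close>

lemma is_quantization1_word_matrix:
  assumes "is_quantization1 f" "w \<in> words {1..<3}"
  shows "f (proj_map (word_matrix (burau3_gen 1) w) (int_point 0 1)) =
    proj_map (word_matrix (burau3_gen qvar) w) (point (vector [0, 1]))"
  using assms burau3_word_class[OF _ assms(2), of 1] burau3_word_class[OF _ assms(2), of qvar]
  unfolding is_quantization1_def carrier_braid_group int_point_def
  by (metis imageI of_int_0 of_int_1 one_neq_zero qvar_nonzero)

lemma is_quantization1_Q1: "is_quantization1 Q1"
proof -
  \<comment> \<open>By transitivity every \<open>p\<close> is the image of \<open>[0:1]\<close>
    under some word, where both maps are forced.\<close>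
  have "f p = q_point qvar p" if "is_quantization1 f" for f p
    using orbit3_UNIV[of p] is_quantization1_word_matrix[OF that]
      is_quantization1_word_matrix[OF is_quantization1_q_point]
    unfolding orbit3_def by auto
  then show ?thesis
    unfolding Q1_def using is_quantization1_q_point by (intro theI[of is_quantization1]) auto
qed

section \<open>Compatibility with the plane\<close>

text \<open>The first two generators have last row \<open>(0, 0, 1)\<close>, so they preserve
  vectors with third coordinate 0; their upper left blocks are the matrices on three
  strands.\<close>

lemma iota_burau_gen:
  assumes t: "t \<noteq> 0" and s: "s \<in> {1..<3}"
  shows "iota (proj_map (burau3_gen t s) p) = proj_map (burau4_gen t s) (iota p)"
proof (rule point2_exhaust[of p])
  fix x y :: 'a assume nz: "x \<noteq> 0 \<or> y \<noteq> 0" and p: "p = point (vector [x, y])"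
  have nz3: "(vector [x, y, 0] :: 'a^3) \<noteq> 0" using nz by (auto simp: vec_eq_iff forall_3)
  have burau4: "burau4_gen t 1 *v vector [x, y, 0] = vector [t * x + y, y, 0]"
    "burau4_gen t 2 *v vector [x, y, 0] = vector [x, t * (y - x), 0]"
    by (simp_all add: burau4_gen_def matrix_vector_mult_def vec_eq_iff forall_3 sum_3 algebra_simps)
  have nz': "(t * x + y, y) \<noteq> (0, 0)" "(x, t * (y - x)) \<noteq> (0, 0)" "(x, y) \<noteq> (0, 0)"
    using nz t by auto
  note iota = nz'[THEN iota_point]
  have "s = 1 \<or> s = 2" using s by fastforce
  then show ?thesis
    by (elim disjE) (use nz3 vector2_nonzero[of x y] nz t in \<open>simp_all add: p iota proj_map_point
      invertible_burau3_gen invertible_burau4_gen burau3_gen_mult_vector burau4\<close>)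
qed

theorem theorem1p3:
  fixes p :: "(rat, 2) proj"
  shows "iota (Q1 p) \<in> Q2 (iota p)"
proof -
  obtain w where w: "w \<in> words {1..<3}"
    and p: "p = proj_map (word_matrix (burau3_gen 1) w) (int_point 0 1)"
    using orbit3_UNIV[of p] by (auto simp: orbit3_def)
  \<comment> \<open>The same word is reread in the braid group on four strands.\<close>
  have w4: "w \<in> words {1..<4}" using w by (auto simp: words_def)
  let ?\<beta> = "word_class {1..<4} (braid_relations 4) w"
  \<comment> \<open>Used twice: at \<open>qvar\<close> for the quantized point, at 1 for the
    condition in \<open>Q2\<close> that the same braid carries \<open>[0:1:0]\<close> to
    \<open>iota p\<close>.\<close>
  have intertwine: "iota (proj_map (word_matrix (burau3_gen t) w) x) =
      proj_map (burau4 t ?\<beta>) (iota x)" if "t \<noteq> 0" for t :: "'b::field" and x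
    unfolding burau4_word_class[OF that w4]
    by (rule intertwines_word_matrix[OF _ _ _ w])
      (simp_all only: iota_burau_gen that invertible_burau3_gen invertible_burau4_gen not_False_eq_True)
  have "iota (Q1 p) = proj_map (burau4 qvar ?\<beta>) (point (vector [0, 1, 0]))"
    using is_quantization1_word_matrix[OF is_quantization1_Q1 w] intertwine[OF qvar_nonzero]
    by (simp add: p iota_point)
  moreover have "proj_map (burau4 1 ?\<beta>) (point (vector [0, 1, 0])) = iota p"
    using intertwine[of "1::rat"] by (simp add: p iota_point int_point_def)
  moreover have "?\<beta> \<in> carrier (braid_group 4)" using w4 by (simp add: carrier_braid_group)
  ultimately show ?thesis unfolding Q2_def by blast
qed

end
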